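(* Fix $k\ge 3$. Let $\vec{\mathbf b}=\{\vec b(m)\}_{m=1}^\infty$, $\vec b(m)=(b_1(m),\dots,b_k(m))$, be such that $b_k(m)=b_k$ for every $m$. Then, for $m\ge 6$, writing $b_i$ for $b_i(m)$, $$f\bigl(m,H(\vec b(m))\bigr)\ge\begin{cases} m^{\frac1{k(b_k+1)}}\left(\dfrac{b_{k-1}}{4(b_{k-2}+2b_{k-1})}\right)^{\frac1k}, & k\ge 4,\\[3mm] m^{\frac1{b_3+2}}\left(\dfrac{b_2}{4(b_1+2b_2)}\right)^{\frac{b_3+1}{b_3+2}}, & k=3.\end{cases}$$
   Context: A hypergraph $H$ on a finite vertex set $V(H)$ is a subset of $2^{V(H)}$; its elements are its edges, $|F|$ denotes the number of edges of $F$, and a subgraph of $F$ is given by a subset of its edges. $F$ is $H$-free if it contains no copy of $H$ as a (not necessarily induced) subgraph. Let $\mathrm{ex}(F,H)$ be the maximum number of edges of an $H$-free subgraph of $F$, and $f(m,H):=\min_{|F|=m}\mathrm{ex}(F,H)$, the minimum being over all hypergraphs $F$ with $m$ edges (not necessarily uniform). For a vector $\vec b=(b_1,\dots,b_k)$ of nonnegative integers, $H(\vec b)$ denotes the $k$-edge hypergraph $\{A_1,\dots,A_k\}$ (unique up to isomorphism) such that for every $1\le\ell\le k$ and every $I\in\binom{[k]}{\ell}$, $$\left|\bigcap_{i\in I}A_i\setminus\bigcup_{i\in[k]\setminus I}A_i\right|=b_\ell .$$ The vectors $\vec b(m)$ in the claim are parameter vectors of such $k$-edge hypergraphs. *)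

theory Defs
  imports Complex_Main
begin

definition hypergraph :: "'a set \<Rightarrow> 'a set set \<Rightarrow> bool" where
  "hypergraph V F \<longleftrightarrow> finite V \<and> F \<subseteq> Pow V"

text \<open>Copies are not necessarily induced. Only the vertices covered by the edges of \<open>H\<close> have to be
  embedded, so isolated vertices of \<open>H\<close> are immaterial.\<close>

definition contains_copy :: "'a set set \<Rightarrow> 'b set set \<Rightarrow> bool" where
  "contains_copy F H \<longleftrightarrow> (\<exists>\<phi>. inj_on \<phi> (\<Union>H) \<and> (\<forall>e\<in>H. \<phi> ` e \<in> F))"

definition H_free :: "'a set set \<Rightarrow> 'b set set \<Rightarrow> bool" where
  "H_free F H \<longleftrightarrow> \<not> contains_copy F H"

definition ex_num :: "'a set set \<Rightarrow> 'b set set \<Rightarrow> nat" where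
  "ex_num F H = Max {card G | G. G \<subseteq> F \<and> H_free G H}"

text \<open>The host hypergraphs range over those with vertices in \<^typ>\<open>nat\<close>; up to isomorphism these are
  all finite hypergraphs, and \<^const>\<open>ex_num\<close> is invariant under isomorphism. All values are at
  most \<open>m\<close>, so the minimum is over a finite nonempty set.\<close>

definition min_ex :: "nat \<Rightarrow> 'b set set \<Rightarrow> nat" where
  "min_ex m H = Min {ex_num F H | F :: nat set set. (\<exists>V. hypergraph V F) \<and> card F = m}"

text \<open>\<open>is_H k b H\<close>: the hypergraph \<open>H\<close> is (a representative of the isomorphism class of) \<open>H(b)\<close> for
  \<open>b = (b 1, \<dots>, b k)\<close>; other values of \<open>b\<close> are ignored. Injectivity of \<open>A\<close> says that \<open>H\<close> really has
  \<open>k\<close> edges, which excludes exactly the vectors with \<open>b 1 = \<dots> = b (k - 1) = 0\<close> when \<open>k \<ge> 2\<close>.\<close>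

definition is_H :: "nat \<Rightarrow> (nat \<Rightarrow> nat) \<Rightarrow> 'a set set \<Rightarrow> bool" where
  "is_H k b H \<longleftrightarrow> (\<exists>V. hypergraph V H) \<and>
     (\<exists>A. inj_on A {1..k} \<and> H = A ` {1..k} \<and>
        (\<forall>l\<in>{1..k}. \<forall>I. I \<subseteq> {1..k} \<and> card I = l \<longrightarrow>
           card ((\<Inter>i\<in>I. A i) - (\<Union>i\<in>{1..k} - I. A i)) = b l))"

end

theory Submission
  imports Defs
begin

text \<open>
  Put \<open>c = b\<^sub>k\<^sub>-\<^sub>1\<close> and \<open>s = b\<^sub>k\<^sub>-\<^sub>2 + 2 b\<^sub>k\<^sub>-\<^sub>1\<close>. The only features of \<open>H(b)\<close> that matter are these:
  the \<open>k\<close> edges have a common core of \<open>b\<^sub>k\<close> points, dropping one edge enlarges the intersection by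
  \<open>c\<close> points, and dropping two edges enlarges it by \<open>s\<close> points. A set of \<open>k\<close> edges of this kind
  is called clustered, and the aim is to find a large subfamily of a given family \<open>F\<close> of \<open>m\<close> edges in
  which every clustered set has a core of more than \<open>b\<^sub>k\<close> points. Let \<open>n\<close> be the
  largest size of such a subfamily, and let \<open>d\<close> be the maximum degree in \<open>F\<close>. There are two ways
  of bounding \<open>n\<close> from below.

  First, take a maximal subfamily \<open>G\<close> of the required kind. Every remaining edge \<open>e\<close> completes a clustered
  set; it contains \<open>k - 2\<close> edges of \<open>G\<close> with intersection \<open>S\<close>, say, such that \<open>e\<close> contains at least a
  proportion \<open>c / s\<close> of the points of \<open>S\<close>. Double counting incidences with \<open>S\<close> shows that each
  choice of the \<open>k - 2\<close> edges accounts for at most \<open>d s / c\<close> edges \<open>e\<close>, and hence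
  \<open>m c \<le> 2 s d n\<^sup>k\<^sup>-\<^sup>2\<close> (lemma \<open>large_subfamily_of_bounded_degree\<close>).

  Second, in the star of a vertex of degree \<open>d\<close> every core contains that vertex, so the required
  core size is effectively one smaller and induction applies to the \<open>d\<close> edges of the star.

  Multiplying the two estimates eliminates \<open>d\<close>, and after \<open>b\<^sub>k + 1\<close> rounds
  \<open>m c^(b\<^sub>k + 1) \<le> (2 s)^(b\<^sub>k + 1) n^((k - 2)(b\<^sub>k + 1) + 1)\<close> (lemma \<open>large_subfamily_with_cores\<close>).
  The induction starts from core size \<open>0\<close>, where the whole family qualifies. For
  \<open>k = 3\<close> the exponent of \<open>n\<close> is \<open>b\<^sub>3 + 2\<close>, and for \<open>k \<ge> 4\<close> it is at most \<open>k (b\<^sub>k + 1)\<close>; taking roots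
  gives both bounds of the theorem.
\<close>

section \<open>Clustered sets of edges\<close>

text \<open>
  Only one-sided bounds are imposed: they are what the counting below uses, and in this form the
  size of the core stays a free parameter.
\<close>

definition clustered :: "nat \<Rightarrow> nat \<Rightarrow> nat \<Rightarrow> 'a set set \<Rightarrow> bool" where
  "clustered k c s K \<longleftrightarrow> card K = k \<and>
     (\<forall>e\<in>K. card (\<Inter>K) + c \<le> card (\<Inter>(K - {e}))) \<and>
     (\<forall>e\<in>K. \<forall>e'\<in>K. e \<noteq> e' \<longrightarrow> card (\<Inter>(K - {e, e'})) \<le> card (\<Inter>K) + s)"

definition clusters_have_core :: "nat \<Rightarrow> nat \<Rightarrow> nat \<Rightarrow> nat \<Rightarrow> 'a set set \<Rightarrow> bool" where
  "clusters_have_core k c s t G \<longleftrightarrow> (\<forall>K\<subseteq>G. clustered k c s K \<longrightarrow> t \<le> card (\<Inter>K))"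

section \<open>The greedy bound in terms of the maximum degree\<close>

lemma nonempty_if_card_pos: "card A = r \<Longrightarrow> 0 < r \<Longrightarrow> A \<noteq> {}"
  by auto

lemma clusters_have_core_if_card_less:
  assumes "finite G" "card G < k"
  shows "clusters_have_core k c s t G"
  using assms card_mono[of G] by (fastforce simp: clusters_have_core_def clustered_def)

text \<open>
  The heavy edges have at least \<open>c |S| / s\<close> incidences each with points of \<open>S\<close>, while the points of
  \<open>S\<close> have at most \<open>d |S|\<close> incidences in total; the factor \<open>|S|\<close> cancels.
\<close>

lemma card_heavy_edges_le:
  fixes c s d :: nat
  assumes "finite F" "finite S" "S \<noteq> {}"
    and deg: "\<And>v. v \<in> S \<Longrightarrow> card {e \<in> F. v \<in> e} \<le> d"
  shows "card {e \<in> F. c * card S \<le> s * card (S \<inter> e)} * c \<le> s * d"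
proof -
  let ?B = "{e \<in> F. c * card S \<le> s * card (S \<inter> e)}"
  have "card ?B * c * card S = (\<Sum>e\<in>?B. c * card S)" by simp
  also have "\<dots> \<le> (\<Sum>e\<in>?B. s * card (S \<inter> e))" by (rule sum_mono) simp
  also have "\<dots> \<le> (\<Sum>e\<in>F. s * card (S \<inter> e))" by (rule sum_mono2) (use assms in auto)
  also have "\<dots> = s * (\<Sum>e\<in>F. card {v \<in> S. v \<in> e})" by (simp add: sum_distrib_left Int_def)
  also have "(\<Sum>e\<in>F. card {v \<in> S. v \<in> e}) = (\<Sum>v\<in>S. card {e \<in> F. v \<in> e})"
    using sum.swap_restrict[OF \<open>finite F\<close> \<open>finite S\<close>, of "\<lambda>e v. 1::nat" "\<lambda>e v. v \<in> e"] by simp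
  also have "s * (\<Sum>v\<in>S. card {e \<in> F. v \<in> e}) \<le> s * (\<Sum>v\<in>S. d)"
    using deg by (intro mult_le_mono sum_mono) auto
  also have "\<dots> = s * d * card S" by simp
  finally show ?thesis using assms(2,3) by (simp add: card_gt_0_iff)
qed

lemma choose_le_power: "n choose r \<le> n ^ r"
  by (cases "r \<le> n") (auto simp: binomial_le_pow binomial_eq_0)

text \<open>
  A maximal admissible \<open>G\<close> works, because any further edge is heavy for the intersection of \<open>k - 2\<close>
  edges of \<open>G\<close>. The set \<open>C\<close> consists of points lying in every edge, whose degrees are
  necessarily large. Removing \<open>C\<close> from all sets in the counting is harmless: it takes the same
  number of points from the intersection and from its part in the edge, all of them in the core.
\<close>

lemma large_subfamily_of_bounded_degree:
  assumes fin: "finite F" "\<And>e. e \<in> F \<Longrightarrow> finite e" and C: "\<And>e. e \<in> F \<Longrightarrow> C \<subseteq> e"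
    and k: "k \<ge> 3" and c: "0 < c" "c \<le> s"
    and deg: "\<And>v. v \<notin> C \<Longrightarrow> card {e \<in> F. v \<in> e} \<le> d" and d: "d \<ge> 1"
  obtains G where "G \<subseteq> F" "clusters_have_core k c s t G"
    "card F * c \<le> 2 * s * d * card G ^ (k - 2)"
proof -
  let ?A = "{G. G \<subseteq> F \<and> clusters_have_core k c s t G}"
  have "finite ?A" using fin by simp
  moreover have "{} \<in> ?A" using k by (simp add: clusters_have_core_if_card_less)
  ultimately obtain G where G: "G \<in> ?A" and max: "\<forall>G'\<in>?A. G \<subseteq> G' \<longrightarrow> G = G'"
    using finite_has_maximal[of ?A] by blast
  have finG: "finite G" using G fin by (auto intro: finite_subset)
  define Ls where "Ls = {L. L \<subseteq> G \<and> card L = k - 2}"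
  \<comment> \<open>If \<open>\<Inter>L - C\<close> is empty, every edge is heavy for it, so this case has to be excluded.\<close>
  define B where "B L = (if \<Inter>L - C = {} then {} else
      {e \<in> F. c * card (\<Inter>L - C) \<le> s * card ((\<Inter>L - C) \<inter> e)})" for L
  have cover: "F - G \<subseteq> (\<Union>L\<in>Ls. B L)"
  proof
    fix e assume e: "e \<in> F - G"
    then have "\<not> clusters_have_core k c s t (insert e G)" using max G by blast
    then obtain K where K: "K \<subseteq> insert e G" "clustered k c s K" "card (\<Inter>K) < t"
      by (auto simp: clusters_have_core_def not_le)
    have "e \<in> K"
    proof (rule ccontr)
      assume "e \<notin> K"
      then have "K \<subseteq> G" using K(1) by blast
      then show False using K G by (simp add: clusters_have_core_def not_le[symmetric])
    qed
    have cK: "card K = k" using K by (simp add: clustered_def)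
    have finK: "finite K" using K finG finite_subset by blast
    have "card (K - {e}) = k - 1" using cK \<open>e \<in> K\<close> finK by simp
    then have "K - {e} \<noteq> {}" using k by (intro nonempty_if_card_pos[of _ "k - 1"]) auto
    then obtain e' where e': "e' \<in> K" "e' \<noteq> e" by blast
    define L where "L = K - {e, e'}"
    have cL: "card L = k - 2" using cK \<open>e \<in> K\<close> e' finK by (simp add: L_def card_Diff_subset)
    have "L \<in> Ls" using K cL by (auto simp: Ls_def L_def)
    obtain e0 where e0: "e0 \<in> L" using cL k by fastforce
    have KF: "K \<subseteq> F" using K e G by blast
    have finS: "finite (\<Inter>L)"
    proof (rule finite_subset)
      show "\<Inter>L \<subseteq> e0" using e0 by blast
      show "finite e0" using e0 KF fin(2) by (auto simp: L_def)
    qed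
    have CK: "C \<subseteq> \<Inter>K" "C \<subseteq> \<Inter>L" using C KF by (auto simp: L_def)
    have finC: "finite C" using finS CK finite_subset by blast
    have eq: "\<Inter>(K - {e'}) = \<Inter>L \<inter> e" using e' \<open>e \<in> K\<close> by (auto simp: L_def)
    have sub: "\<Inter>K \<subseteq> \<Inter>L" by (auto simp: L_def)
    have a: "card C \<le> card (\<Inter>K)"
      using CK sub finS by (meson card_mono finite_subset)
    have lo: "card (\<Inter>K) + c \<le> card (\<Inter>L \<inter> e)"
      using K(2) e' unfolding clustered_def eq[symmetric] by blast
    have hi: "card (\<Inter>L) \<le> card (\<Inter>K) + s"
      using K(2) e' \<open>e \<in> K\<close> unfolding clustered_def L_def by blast
    have Ce: "C \<subseteq> \<Inter>L \<inter> e" using CK C e by blast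
    have c1: "card (\<Inter>L - C) = card (\<Inter>L) - card C"
      using CK finC by (simp add: card_Diff_subset)
    have c2: "card ((\<Inter>L - C) \<inter> e) = card (\<Inter>L \<inter> e) - card C"
      using Ce finC by (metis Int_Diff Int_commute card_Diff_subset)
    \<comment> \<open>The ratio \<open>(x + c) / (x + s)\<close> is at least \<open>c / s\<close>, however large the rest \<open>x\<close> of the core is.\<close>
    obtain x where x: "card (\<Inter>K) = card C + x" using a le_Suc_ex by blast
    have "c * card (\<Inter>L - C) \<le> c * (x + s)"
      using c1 hi x by (intro mult_le_mono2) simp
    also have "\<dots> \<le> s * (x + c)" using c by (simp add: algebra_simps)
    also have "\<dots> \<le> s * card ((\<Inter>L - C) \<inter> e)"
      using c2 lo x by (intro mult_le_mono2) simp
    finally have "c * card (\<Inter>L - C) \<le> s * card ((\<Inter>L - C) \<inter> e)" .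
    moreover have "\<Inter>L - C \<noteq> {}"
    proof
      assume "\<Inter>L - C = {}"
      then have "card ((\<Inter>L - C) \<inter> e) = 0" by (simp only: Int_empty_left card.empty)
      then show False using c2 lo x c by simp
    qed
    ultimately have "e \<in> B L" using e by (simp add: B_def)
    then show "e \<in> (\<Union>L\<in>Ls. B L)" using \<open>L \<in> Ls\<close> by blast
  qed
  have Bc: "card (B L) * c \<le> s * d" if "L \<in> Ls" for L
  proof (cases "\<Inter>L - C = {}")
    case False
    have "L \<noteq> {}" using that k by (auto simp: Ls_def)
    then have "finite (\<Inter>L)" using that G fin
      by (metis (no_types, lifting) Ls_def Inter_lower all_not_in_conv finite_subset mem_Collect_eq subsetD)
    then show ?thesis
      using card_heavy_edges_le[of F "\<Inter>L - C" d c s] fin False deg by (simp add: B_def)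
  qed (simp add: B_def)
  have finLs: "finite Ls" using finG by (simp add: Ls_def)
  have finB: "finite (B L)" for L using fin by (simp add: B_def)
  have "card (F - G) * c \<le> card (\<Union>L\<in>Ls. B L) * c"
    using cover finLs finB by (intro mult_le_mono card_mono) auto
  also have "\<dots> \<le> (\<Sum>L\<in>Ls. card (B L)) * c"
    using card_UN_le[OF finLs, of B] by simp
  also have "\<dots> \<le> card Ls * (s * d)"
    using sum_bounded_above[of Ls "\<lambda>L. card (B L) * c" "s * d"] Bc by (simp add: sum_distrib_right)
  also have "card Ls = card G choose (k - 2)" using finG by (simp add: Ls_def n_subsets)
  also have "(card G choose (k - 2)) * (s * d) \<le> card G ^ (k - 2) * (s * d)"
    using choose_le_power by (rule mult_le_mono1)
  finally have 1: "card (F - G) * c \<le> card G ^ (k - 2) * (s * d)" .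
  \<comment> \<open>The edges of \<open>G\<close> itself fit into a second copy of the same bound, whence the factor \<open>2\<close>.\<close>
  have "card G \<le> card G ^ (k - 2)" using k by (cases "card G = 0") (auto intro: self_le_power)
  moreover have "c \<le> s * d" using c d by (metis le_trans mult.right_neutral mult_le_mono2)
  ultimately have 2: "card G * c \<le> card G ^ (k - 2) * (s * d)" by (rule mult_le_mono)
  have "card F = card G + card (F - G)"
    using G fin by (simp add: card_Diff_subset finG card_mono)
  then have "card F * c \<le> 2 * s * d * card G ^ (k - 2)" using 1 2 by (simp add: algebra_simps)
  then show ?thesis using that G by blast
qed

section \<open>Induction on the size of the core\<close>

text \<open>
  The set \<open>C\<close> collects the vertices whose stars have been taken so far. Keeping them in the edges,
  instead of passing to links, leaves the edges unchanged throughout the induction: descending to the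
  star of \<open>v\<close> moves one point of the demanded core into \<open>C\<close>, and the bound \<open>card C + u\<close> on core
  sizes stays the same while \<open>u\<close> drops by one.
\<close>

lemma large_subfamily_with_cores:
  assumes "finite F" "\<And>e. e \<in> F \<Longrightarrow> finite e" "\<And>e. e \<in> F \<Longrightarrow> C \<subseteq> e"
    and k: "k \<ge> 3" and c: "0 < c" "c \<le> s"
  shows "\<exists>G\<subseteq>F. clusters_have_core k c s (card C + u) G \<and>
    card F * c ^ u \<le> (2 * s) ^ u * card G ^ ((k - 2) * u + 1)"
  using assms(1-3)
proof (induction u arbitrary: F C)
  case 0
  have "clusters_have_core k c s (card C) F"
    unfolding clusters_have_core_def
  proof (intro allI impI)
    fix K assume K: "K \<subseteq> F" "clustered k c s K"
    then obtain e where "e \<in> K" using k by (fastforce simp: clustered_def)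
    then have "finite (\<Inter>K)" using K 0 by (meson Inter_lower finite_subset subsetD)
    moreover have "C \<subseteq> \<Inter>K" using K 0 by blast
    ultimately show "card C \<le> card (\<Inter>K)" by (rule card_mono)
  qed
  then show ?case by (intro exI[of _ F]) simp
next
  case (Suc u)
  show ?case
  proof (cases "card F \<le> 1")
    case True
    have "card F * c ^ Suc u \<le> (2 * s) ^ Suc u * card F ^ ((k - 2) * Suc u + 1)"
    proof (cases "card F = 0")
      case False
      then have "card F = 1" using True by simp
      moreover have "c ^ Suc u \<le> (2 * s) ^ Suc u" using c by (intro power_mono) auto
      ultimately show ?thesis by simp
    qed simp
    then show ?thesis
      using clusters_have_core_if_card_less[of F k] Suc.prems True k by (intro exI[of _ F]) simp
  next
    case False
    \<comment> \<open>With two or more edges, some vertex outside \<open>C\<close> is covered, so the maximum degree is positive.\<close>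
    define deg where "deg v = card {e \<in> F. v \<in> e}" for v
    have "\<exists>e\<in>F. e \<noteq> C"
    proof (rule ccontr)
      assume "\<not> (\<exists>e\<in>F. e \<noteq> C)"
      then have "F \<subseteq> {C}" by blast
      then show False using False card_mono[of "{C}" F] by simp
    qed
    then have ne: "\<Union>F - C \<noteq> {}" using Suc.prems by blast
    have finU: "finite (\<Union>F - C)" using Suc.prems by simp
    obtain v where v: "v \<in> \<Union>F - C" and vmax: "\<And>w. w \<in> \<Union>F - C \<Longrightarrow> deg w \<le> deg v"
      using ne finU obtains_MAX[of "\<Union>F - C" deg] by (metis Max_ge finite_imageI imageI)
    have deg: "deg w \<le> deg v" if "w \<notin> C" for w
    proof (cases "w \<in> \<Union>F")
      case False
      then have "{e \<in> F. w \<in> e} = {}" by blast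
      then show ?thesis unfolding deg_def[of w] by (simp only: card.empty)
    qed (use that vmax in blast)
    have "deg v \<ge> 1"
      using v Suc.prems(1) by (auto simp: deg_def Suc_le_eq card_gt_0_iff)
    then obtain G1 where G1: "G1 \<subseteq> F" "clusters_have_core k c s (card C + Suc u) G1"
      "card F * c \<le> 2 * s * deg v * card G1 ^ (k - 2)"
      using large_subfamily_of_bounded_degree[of F C k c s "deg v" "card C + Suc u"]
        Suc.prems k c deg deg_def by metis
    obtain e where "e \<in> F" using False by fastforce
    then have "finite C" using Suc.prems finite_subset by blast
    then have cC: "card (insert v C) + u = card C + Suc u" using v by simp
    obtain G2 where G2: "G2 \<subseteq> {e \<in> F. v \<in> e}" "clusters_have_core k c s (card C + Suc u) G2"
      "deg v * c ^ u \<le> (2 * s) ^ u * card G2 ^ ((k - 2) * u + 1)"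
      using Suc.IH[of "{e \<in> F. v \<in> e}" "insert v C"] Suc.prems unfolding cC deg_def by auto
    define j where "j = k - 2"
    define n where "n = max (card G1) (card G2)"
    have "card F * c ^ Suc u = (card F * c) * c ^ u" by simp
    also have "\<dots> \<le> (2 * s * deg v * card G1 ^ (k - 2)) * c ^ u" using G1 by (intro mult_le_mono1)
    also have "\<dots> = (2 * s * card G1 ^ (k - 2)) * (deg v * c ^ u)" by (simp only: mult_ac)
    also have "\<dots> \<le> (2 * s * card G1 ^ (k - 2)) * ((2 * s) ^ u * card G2 ^ ((k - 2) * u + 1))"
      using G2 by (intro mult_le_mono2)
    also have "\<dots> \<le> (2 * s * n ^ (k - 2)) * ((2 * s) ^ u * n ^ ((k - 2) * u + 1))"
      by (intro mult_le_mono power_mono) (auto simp: n_def)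
    also have "\<dots> = (2 * s) ^ Suc u * n ^ ((k - 2) * Suc u + 1)"
      unfolding j_def[symmetric] by (simp add: power_add algebra_simps)
    finally have *: "card F * c ^ Suc u \<le> (2 * s) ^ Suc u * n ^ ((k - 2) * Suc u + 1)" .
    show ?thesis
    proof (cases "card G1 \<le> card G2")
      case True
      then have "n = card G2" by (simp add: n_def)
      then show ?thesis using * G2 by (intro exI[of _ G2]) auto
    next
      case False
      then have "n = card G1" by (simp add: n_def)
      then show ?thesis using * G1 by (intro exI[of _ G1]) auto
    qed
  qed
qed

section \<open>Copies of the hypergraph are clustered\<close>

text \<open>
  The defining property of \<open>H(b)\<close>, freed from the indexing of the edges.
\<close>

lemma is_H_region_cards:
  assumes "is_H k b H"
  shows "card H = k" "finite (\<Union>H)"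
    and "\<And>L. L \<subseteq> H \<Longrightarrow> L \<noteq> {} \<Longrightarrow> card (\<Inter>L - \<Union>(H - L)) = b (card L)"
proof -
  obtain V A where V: "hypergraph V H" and A: "inj_on A {1..k}" "H = A ` {1..k}"
    "\<And>I. I \<subseteq> {1..k} \<Longrightarrow> card I \<in> {1..k} \<Longrightarrow>
       card ((\<Inter>i\<in>I. A i) - (\<Union>i\<in>{1..k} - I. A i)) = b (card I)"
    using assms unfolding is_H_def by blast
  show "card H = k" using A by (simp add: card_image)
  show "finite (\<Union>H)" using V unfolding hypergraph_def by (meson Sup_le_iff PowD finite_subset subsetD)
  fix L assume L: "L \<subseteq> H" "L \<noteq> {}"
  then obtain I where I: "I \<subseteq> {1..k}" "L = A ` I" using A(2) by (meson subset_imageE)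
  have "finite I" using I finite_subset by blast
  have cI: "card L = card I" using I A by (metis card_image inj_on_subset)
  have "card I \<in> {1..k}"
    using I L \<open>finite I\<close> card_mono[of "{1..k}" I] by (auto simp: Suc_le_eq card_gt_0_iff)
  moreover have "H - L = A ` ({1..k} - I)"
    unfolding A(2) I(2) using inj_on_image_set_diff[OF A(1), of "{1..k}" I] I by auto
  ultimately show "card (\<Inter>L - \<Union>(H - L)) = b (card L)"
    using A(3)[OF I(1)] cI I(2) by simp
qed

text \<open>
  The intersection of all but two edges splits into four regions of the Venn diagram, according to which
  of the two omitted edges contain a point: both (\<open>b k\<close>), exactly one (twice \<open>b (k - 1)\<close>), or
  neither (\<open>b (k - 2)\<close>).
\<close>

lemma is_H_card_Inter:
  assumes H: "is_H k b H" and k: "k \<ge> 3"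
  shows "card (\<Inter>H) = b k"
    and "\<And>e. e \<in> H \<Longrightarrow> card (\<Inter>(H - {e})) = b k + b (k - 1)"
    and "\<And>e e'. e \<in> H \<Longrightarrow> e' \<in> H \<Longrightarrow> e \<noteq> e' \<Longrightarrow>
      card (\<Inter>(H - {e, e'})) = b k + (b (k - 2) + 2 * b (k - 1))"
proof -
  note R = is_H_region_cards[OF H]
  have finH: "finite H" using R(1) k by (metis card.infinite not_numeral_le_zero)
  have finI: "finite (\<Inter>L)" if "L \<subseteq> H" "L \<noteq> {}" for L
    using that R(2) by (meson Inter_subset Union_mono finite_subset subset_trans Union_upper subsetD)
  have Hne: "H \<noteq> {}" using R(1) k by auto
  show full: "card (\<Inter>H) = b k" using R(3)[of H] Hne R(1) by simp
  have one: "card (\<Inter>(H - {e}) - e) = b (k - 1)" "H - {e} \<noteq> {}" if e: "e \<in> H" for e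
  proof -
    have cc: "card (H - {e}) = k - 1" using e finH R(1) by simp
    show ne: "H - {e} \<noteq> {}" using cc k by (intro nonempty_if_card_pos[of _ "k - 1"]) auto
    have "H - (H - {e}) = {e}" using e by blast
    then show "card (\<Inter>(H - {e}) - e) = b (k - 1)" using R(3)[of "H - {e}"] ne cc by auto
  qed
  show two: "card (\<Inter>(H - {e})) = b k + b (k - 1)" if e: "e \<in> H" for e
  proof -
    have "\<Inter>(H - {e}) = \<Inter>H \<union> (\<Inter>(H - {e}) - e)" using e by blast
    moreover have "card (\<Inter>H \<union> (\<Inter>(H - {e}) - e)) = card (\<Inter>H) + card (\<Inter>(H - {e}) - e)"
      using finI[of H] finI[of "H - {e}"] one e Hne by (intro card_Un_disjoint) auto
    ultimately show ?thesis using full one(1)[OF e] by simp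
  qed
  fix e e' assume e: "e \<in> H" "e' \<in> H" "e \<noteq> e'"
  let ?L = "H - {e, e'}"
  have cL: "card ?L = k - 2" using e finH R(1) by (simp add: card_Diff_subset)
  then have ne: "?L \<noteq> {}" using k by (intro nonempty_if_card_pos[of _ "k - 2"]) auto
  have fL: "finite (\<Inter>?L)" using finI[OF _ ne] by simp
  have "H - ?L = {e, e'}" using e by blast
  then have out: "card (\<Inter>?L - (e \<union> e')) = b (k - 2)"
    using R(3)[of ?L] ne cL by auto
  have p1: "\<Inter>?L = \<Inter>(H - {e}) \<union> (\<Inter>(H - {e'}) - e') \<union> (\<Inter>?L - (e \<union> e'))" using e by blast
  have dis: "\<Inter>(H - {e}) \<inter> (\<Inter>(H - {e'}) - e') = {}"
    "(\<Inter>(H - {e}) \<union> (\<Inter>(H - {e'}) - e')) \<inter> (\<Inter>?L - (e \<union> e')) = {}"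
    using e by blast+
  have "card (\<Inter>(H - {e}) \<union> (\<Inter>(H - {e'}) - e') \<union> (\<Inter>?L - (e \<union> e')))
     = card (\<Inter>(H - {e})) + card (\<Inter>(H - {e'}) - e') + card (\<Inter>?L - (e \<union> e'))"
    using fL finI[OF _ one(2)[OF e(1)]] finI[OF _ one(2)[OF e(2)]] dis
    by (simp add: card_Un_disjoint)
  then show "card (\<Inter>?L) = b k + (b (k - 2) + 2 * b (k - 1))"
    using p1 out two[OF e(1)] one(1)[OF e(2)] by simp
qed

text \<open>
  An embedding is injective on the union of the edges, so it commutes with nonempty intersections
  and preserves their sizes. Since \<open>k \<ge> 3\<close>, dropping two edges leaves a nonempty family.
\<close>

lemma copy_is_clustered:
  assumes H: "is_H k b H" and k: "k \<ge> 3" and copy: "contains_copy G H"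
  obtains K where "K \<subseteq> G" "clustered k (b (k - 1)) (b (k - 2) + 2 * b (k - 1)) K"
    "card (\<Inter>K) = b k"
proof -
  obtain \<phi> where \<phi>: "inj_on \<phi> (\<Union>H)" "\<And>e. e \<in> H \<Longrightarrow> \<phi> ` e \<in> G"
    using copy unfolding contains_copy_def by blast
  note R = is_H_region_cards[OF H] and I = is_H_card_Inter[OF H k]
  define K where "K = (\<lambda>e. \<phi> ` e) ` H"
  have inj: "inj_on (\<lambda>e. \<phi> ` e) H"
    using \<phi>(1) by (intro inj_onI) (metis Union_upper inj_on_image_eq_iff)
  have cI: "card (\<Inter>((\<lambda>e. \<phi> ` e) ` L)) = card (\<Inter>L)" if L: "L \<subseteq> H" "L \<noteq> {}" for L
  proof -
    obtain j where j: "j \<in> L" using L by blast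
    have "\<phi> ` (\<Inter>L) = \<Inter>((\<lambda>e. \<phi> ` e) ` L)"
      using image_INT[OF \<phi>(1), of L "\<lambda>e. e" j] L j by auto
    moreover have "inj_on \<phi> (\<Inter>L)" using \<phi>(1) by (rule inj_on_subset) (use L j in blast)
    ultimately show ?thesis by (metis card_image)
  qed
  have D: "K - (\<lambda>e. \<phi> ` e) ` J = (\<lambda>e. \<phi> ` e) ` (H - J)" if "J \<subseteq> H" for J
    unfolding K_def using inj_on_image_set_diff[OF inj, of H J] that by auto
  have ne: "H - J \<noteq> {}" if "J \<subseteq> H" "card J \<le> 2" for J
  proof
    assume "H - J = {}"
    then have "J = H" using that by blast
    then show False using that k R(1) by simp
  qed
  have full: "card (\<Inter>K) = b k" using cI[of H] ne[of "{}"] I(1) by (simp add: K_def)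
  have "clustered k (b (k - 1)) (b (k - 2) + 2 * b (k - 1)) K"
    unfolding clustered_def full
  proof (intro conjI ballI impI)
    show "card K = k" using inj R(1) by (simp add: K_def card_image)
  next
    fix x assume "x \<in> K"
    then obtain e where e: "e \<in> H" "x = \<phi> ` e" by (auto simp: K_def)
    have "card (\<Inter>(K - {x})) = card (\<Inter>(H - {e}))"
      using D[of "{e}"] cI[of "H - {e}"] ne[of "{e}"] e by simp
    then show "b k + b (k - 1) \<le> card (\<Inter>(K - {x}))" using I(2)[OF e(1)] by simp
  next
    fix x y assume "x \<in> K" "y \<in> K" "x \<noteq> y"
    then obtain e e' where e: "e \<in> H" "x = \<phi> ` e" "e' \<in> H" "y = \<phi> ` e'" "e \<noteq> e'"
      by (auto simp: K_def)
    have "card (\<Inter>(K - {x, y})) = card (\<Inter>(H - {e, e'}))"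
      using D[of "{e, e'}"] cI[of "H - {e, e'}"] ne[of "{e, e'}"] e by simp
    then show "card (\<Inter>(K - {x, y})) \<le> b k + (b (k - 2) + 2 * b (k - 1))"
      using I(3) e by simp
  qed
  moreover have "K \<subseteq> G" using \<phi>(2) by (auto simp: K_def)
  ultimately show ?thesis using that full by blast
qed

section \<open>The extremal numbers\<close>

lemma card_le_ex_num:
  assumes "finite F" "G \<subseteq> F" "H_free G H"
  shows "card G \<le> ex_num F H"
proof -
  have "finite {card G | G. G \<subseteq> F \<and> H_free G H}"
    using assms(1) by (auto intro: finite_subset[of _ "card ` Pow F"])
  then show ?thesis unfolding ex_num_def using assms by (intro Max_ge) auto
qed

lemma ex_num_le_card:
  assumes "finite F" "H \<noteq> {}"
  shows "ex_num F H \<le> card F"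
proof -
  have fin: "finite {card G | G. G \<subseteq> F \<and> H_free G H}"
    using assms(1) by (auto intro: finite_subset[of _ "card ` Pow F"])
  have "H_free {} H" using assms by (auto simp: H_free_def contains_copy_def)
  then have "{card G | G. G \<subseteq> F \<and> H_free G H} \<noteq> {}" by blast
  then show ?thesis unfolding ex_num_def using fin assms(1)
    by (subst Max_le_iff) (auto intro: card_mono)
qed

lemma min_ex_attained:
  assumes "H \<noteq> {}"
  obtains F :: "nat set set" and V where "hypergraph V F" "card F = m" "min_ex m H = ex_num F H"
proof -
  let ?S = "{ex_num F H | F :: nat set set. (\<exists>V. hypergraph V F) \<and> card F = m}"
  have finF: "finite F" if "hypergraph V F" for V and F :: "nat set set"
    using that unfolding hypergraph_def by (metis finite_Pow_iff finite_subset)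
  have "?S \<subseteq> {..m}" using ex_num_le_card[OF finF assms] by auto
  then have "finite ?S" using finite_subset by blast
  moreover have "?S \<noteq> {}"
  proof -
    let ?F = "(\<lambda>i. {i}) ` {..<m}"
    have "hypergraph {..<m} ?F" by (auto simp: hypergraph_def)
    moreover have "card ?F = m" by (simp add: card_image inj_on_def)
    ultimately show ?thesis by blast
  qed
  ultimately have "Min ?S \<in> ?S" by (rule Min_in)
  then show ?thesis using that unfolding min_ex_def by auto
qed

section \<open>The lower bound\<close>

lemma root_lower_bound:
  fixes m n a :: real
  assumes "0 \<le> n" "0 \<le> m" "0 < a" "0 < q" and le: "m * a ^ u \<le> n ^ q"
  shows "m powr (1 / real q) * a powr (real u / real q) \<le> n"
proof -
  have "m powr (1 / real q) * a powr (real u / real q) = (m * a ^ u) powr (1 / real q)"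
    using assms by (simp add: powr_mult powr_powr flip: powr_realpow)
  also have "\<dots> \<le> (n ^ q) powr (1 / real q)" using le assms by (intro powr_mono2) auto
  also have "\<dots> = n"
    using assms by (cases "n = 0") (auto simp: powr_powr simp flip: powr_realpow)
  finally show ?thesis .
qed

text \<open>
  Demanding cores of at least \<open>b k + 1\<close> points excludes copies of \<open>H\<close>, whose core has only \<open>b k\<close>.
  No vertex is prescribed to lie in all edges, so the induction is used with \<open>C = {}\<close>.
\<close>

lemma min_ex_polynomial_bound:
  assumes H: "is_H k b H" and k: "k \<ge> 3" and pos: "b (k - 1) > 0"
  shows "m * b (k - 1) ^ Suc (b k) \<le>
    (2 * (b (k - 2) + 2 * b (k - 1))) ^ Suc (b k) * min_ex m H ^ ((k - 2) * Suc (b k) + 1)"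
proof -
  let ?s = "b (k - 2) + 2 * b (k - 1)"
  have "H \<noteq> {}" using is_H_region_cards(1)[OF H] k by auto
  then obtain F :: "nat set set" and V where F: "hypergraph V F" "card F = m" "min_ex m H = ex_num F H"
    using min_ex_attained by blast
  have fin: "finite F" "\<And>e. e \<in> F \<Longrightarrow> finite e"
    using F(1) unfolding hypergraph_def by (auto intro: finite_subset)
  obtain G where G: "G \<subseteq> F" "clusters_have_core k (b (k - 1)) ?s (Suc (b k)) G"
    "m * b (k - 1) ^ Suc (b k) \<le> (2 * ?s) ^ Suc (b k) * card G ^ ((k - 2) * Suc (b k) + 1)"
    using large_subfamily_with_cores[of F "{}" k "b (k - 1)" ?s "Suc (b k)"] fin k pos F(2)
    by auto
  have "H_free G H"
    unfolding H_free_def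
  proof
    assume "contains_copy G H"
    then obtain K where "K \<subseteq> G" "clustered k (b (k - 1)) ?s K" "card (\<Inter>K) = b k"
      using copy_is_clustered[OF H k] by blast
    then have "Suc (b k) \<le> b k" using G(2) unfolding clusters_have_core_def by metis
    then show False by simp
  qed
  then have "card G \<le> min_ex m H" using card_le_ex_num G fin F by metis
  then have "card G ^ ((k - 2) * Suc (b k) + 1) \<le> min_ex m H ^ ((k - 2) * Suc (b k) + 1)"
    by (rule power_mono) simp
  then show ?thesis using G(3) by (meson le_trans mult_le_mono2)
qed

theorem theorem2p8:
  fixes k bk :: nat
    and b :: "nat \<Rightarrow> nat \<Rightarrow> nat"
    and H :: "nat \<Rightarrow> 'a set set"
  assumes "k \<ge> 3"
    and "\<And>m. m \<ge> 1 \<Longrightarrow> is_H k (b m) (H m)"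
    and "\<And>m. m \<ge> 1 \<Longrightarrow> b m k = bk"
  shows "\<forall>m\<ge>6. real (min_ex m (H m)) \<ge>
    (if k \<ge> 4 then
       real m powr (1 / (real k * (real bk + 1))) *
       (real (b m (k - 1)) / (4 * (real (b m (k - 2)) + 2 * real (b m (k - 1))))) powr (1 / real k)
     else
       real m powr (1 / (real bk + 2)) *
       (real (b m 2) / (4 * (real (b m 1) + 2 * real (b m 2)))) powr ((real bk + 1) / (real bk + 2)))"
proof (intro allI impI)
  fix m :: nat assume m: "m \<ge> 6"
  define c s u n where "c = b m (k - 1)" and "s = b m (k - 2) + 2 * c" and "u = Suc bk"
    and "n = min_ex m (H m)"
  define a where "a = real c / (4 * real s)"
  have goal: "real n \<ge> (if k \<ge> 4 then real m powr (1 / (real k * real u)) * a powr (1 / real k)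
     else real m powr (1 / real (u + 1)) * a powr (real u / real (u + 1)))"
    \<comment> \<open>If \<open>c = 0\<close> then \<open>a = 0\<close>, and the right-hand side vanishes because \<open>0 powr x = 0\<close>.\<close>
  proof (cases "c = 0")
    case False
    then have c: "c > 0" "s > 0" by (auto simp: s_def)
    have bound: "m * c ^ u \<le> (2 * s) ^ u * n ^ ((k - 2) * u + 1)"
      using min_ex_polynomial_bound[of k "b m" "H m" m] assms m c
      unfolding c_def s_def u_def n_def by simp
    have "0 < m * c ^ u" using m c by simp
    then have "n > 0" using bound by (cases "n = 0") auto
    have a: "a > 0" using c by (simp add: a_def)
    have "a \<le> real c / (2 * real s)" using c by (simp add: a_def field_simps)
    then have "real m * a ^ u \<le> real m * (real c / (2 * real s)) ^ u"
      using a by (intro mult_left_mono power_mono) auto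
    also have "\<dots> = real (m * c ^ u) / (2 * real s) ^ u" by (simp add: power_divide)
    also have "\<dots> \<le> real n ^ ((k - 2) * u + 1)"
    proof -
      have "real (m * c ^ u) \<le> real ((2 * s) ^ u * n ^ ((k - 2) * u + 1))"
        using bound by (simp only: of_nat_le_iff)
      then show ?thesis using c by (simp add: field_simps)
    qed
    finally have main: "real m * a ^ u \<le> real n ^ ((k - 2) * u + 1)" .
    show ?thesis
    proof (cases "k \<ge> 4")
      case True
      have "(k - 2) * u + 1 \<le> (k - 2) * u + 2 * u" by (simp add: u_def)
      also have "\<dots> = (k - 2 + 2) * u" by (simp only: add_mult_distrib)
      also have "k - 2 + 2 = k" using True by simp
      finally have "real n ^ ((k - 2) * u + 1) \<le> real n ^ (k * u)"
        using \<open>n > 0\<close> by (intro power_increasing) auto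
      then have "real m powr (1 / real (k * u)) * a powr (real u / real (k * u)) \<le> real n"
        using main a True by (intro root_lower_bound) (auto simp: u_def)
      moreover have "real u / real (k * u) = 1 / real k"
        unfolding of_nat_mult by (rule nonzero_divide_mult_cancel_right) (simp add: u_def)
      ultimately show ?thesis using True by simp
    next
      case False
      then have "k = 3" using assms(1) by simp
      then have "real m powr (1 / real (u + 1)) * a powr (real u / real (u + 1)) \<le> real n"
        using main a by (intro root_lower_bound) auto
      then show ?thesis using False by simp
    qed
  qed (simp add: a_def)
  have k3: "k = 3" if "\<not> k \<ge> 4" using that assms(1) by simp
  show "real (min_ex m (H m)) \<ge>
    (if k \<ge> 4 then
       real m powr (1 / (real k * (real bk + 1))) *
       (real (b m (k - 1)) / (4 * (real (b m (k - 2)) + 2 * real (b m (k - 1))))) powr (1 / real k)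
     else
       real m powr (1 / (real bk + 2)) *
       (real (b m 2) / (4 * (real (b m 1) + 2 * real (b m 2)))) powr ((real bk + 1) / (real bk + 2)))"
    using goal k3 by (auto simp: a_def c_def s_def u_def n_def add_ac)
qed

end
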